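(* Let $G$ be a finite connected plane graph, with overlaid Tait graph $\Gamma(G)$ and induced colouring $\varepsilon_G$ of the matching complex $\mathrm{M}(\Gamma(G))$. Then for every $k>0$ there is an isomorphism $$\mathrm{H}^h_*(\mathrm{M}(\Gamma(G)),\varepsilon_G,k)\cong\bigoplus_{\substack{\mu\in Match(B(G^* ))\\ G(\mu)\neq\emptyset\\ |\mu|=k}}\widetilde{\mathrm{H}}_*(\mathrm{M}(B(G(\mu))))\;\oplus\bigoplus_{\substack{\mu\in Match(B(G^* ))\\ G(\mu)=\emptyset\\ |\mu|=k}}\mathbb{F}_{(k-1,k)},$$ where each summand $\mathbb{F}_{(k-1,k)}$ is a copy of $\mathbb{F}$ in bidegree (dimension, weight) $=(k-1,k)$. For $k=0$, $$\mathrm{H}^h_*(\mathrm{M}(\Gamma(G)),\varepsilon_G,0)\cong\mathrm{H}_*(\mathrm{M}(B(G))).$$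
   Context: $\mathbb{F}$ is the field with two elements. For a graph $H$, $Match(H)$ is the set of matchings of $H$ (sets of pairwise vertex-disjoint edges), $|\mu|$ the number of edges of a matching $\mu$, and the matching complex $\mathrm{M}(H)$ is the simplicial complex whose vertices are the edges of $H$ and whose simplices are the nonempty matchings. For a plane graph $G$ with plane dual $G^*$, drawn so that each edge $e$ of $G$ crosses its dual edge $e^*$ exactly once at a point $c_e$, the overlaid Tait graph $\Gamma(G)$ has vertices $V(G)\sqcup V(G^* )\sqcup\{c_e\}$ and edges the half-edges of $G$ and $G^*$ (the segments from $c_e$ to the endpoints of $e$ and of $e^*$). An edge of $\Gamma(G)$ is black if it has an endpoint in $V(G)$ and white if it has an endpoint in $V(G^* )$; the black edges form the barycentric subdivision $B(G)$ of $G$ and the white edges form $B(G^* )$. This defines a black/white colouring $\varepsilon_G$ of the vertices of $\mathrm{M}(\Gamma(G))$. For $\mu\in Match(B(G^* ))$, $G(\mu)$ is the subgraph of $G$ obtained by deleting every edge $e$ whose crossing point $c_e$ (the barycentre of $e^*$) is covered by $\mu$; $G(\mu)=\emptyset$ means $G(\mu)$ has no edges. For a simplicial complex $X$ with a black/white vertex colouring $\varepsilon$: the weight of a simplex is its number of white vertices; the horizontal differential $\partial_h$ on the simplicial chain complex $C_*(X)$ over $\mathbb{F}$ sends a simplex $\sigma$ to the sum of the faces $\sigma\setminus\{v\}$ over the black vertices $v$ of $\sigma$; $\mathrm{H}^h_*(X,\varepsilon,k)$ is the homology of $(C_*(X),\partial_h)$ restricted to simplices of weight $k$. $\widetilde{\mathrm{H}}$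 denotes reduced homology, computed from the simplicial chain complex augmented by one generator in degree $-1$. *)

theory Defs
  imports
    "HOL-Analysis.Analysis"
    "HOL-Algebra.Product_Groups"
    "HOL-Library.Z2"
    "HOL-Library.Poly_Mapping"
begin

section \<open>Graphs and matchings\<close>

text \<open>Loops and multiple edges are allowed, since the plane dual of a simple graph may have both;
  the set \<open>ends G e\<close> has one element if \<open>e\<close> is a loop and two elements otherwise.\<close>

record ('v, 'x) graph =
  verts :: "'v set"
  edges :: "'x set"
  ends :: "'x \<Rightarrow> 'v set"

definition connected_graph :: "('v, 'x, 'm) graph_scheme \<Rightarrow> bool" where
  "connected_graph G \<longleftrightarrow> verts G \<noteq> {} \<and>
     (\<forall>u\<in>verts G. \<forall>v\<in>verts G. (u, v) \<in> {(a, b). \<exists>e\<in>edges G. ends G e = {a, b}}\<^sup>*)"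

definition Match :: "('v, 'x, 'm) graph_scheme \<Rightarrow> 'x set set" where
  "Match H = {\<mu>. finite \<mu> \<and> \<mu> \<subseteq> edges H \<and> pairwise (\<lambda>x y. disjnt (ends H x) (ends H y)) \<mu>}"

section \<open>Homology of simplicial complexes over the field with two elements\<close>

text \<open>A simplicial complex is given by the set of its simplices, which are nonempty finite sets of
  vertices.\<close>

definition matching_complex :: "('v, 'x, 'm) graph_scheme \<Rightarrow> 'x set set" where
  "matching_complex H = Match H - {{}}"

text \<open>In the following four definitions, \<open>K\<close> is a family of finite sets, the generators; a generator
  \<open>\<sigma>\<close> has degree \<open>card \<sigma> - 1\<close>. The family need not be closed under taking subsets, and it may contain
  the empty set, as the generator of degree \<open>-1\<close> of an augmented complex. The differential sums over
  those faces \<open>\<sigma> - {v}\<close> which are again generators and for which the vertex \<open>v\<close> satisfies \<open>b\<close>.\<close>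

definition chain_group :: "'x set set \<Rightarrow> int \<Rightarrow> ('x set \<Rightarrow>\<^sub>0 bit) monoid" where
  "chain_group K n =
     \<lparr>carrier = {a. Poly_Mapping.keys a \<subseteq> {\<sigma> \<in> K. int (card \<sigma>) = n + 1}}, mult = (+), one = 0\<rparr>"

definition differential ::
    "'x set set \<Rightarrow> ('x \<Rightarrow> bool) \<Rightarrow> ('x set \<Rightarrow>\<^sub>0 bit) \<Rightarrow> ('x set \<Rightarrow>\<^sub>0 bit)" where
  "differential K b a =
     (\<Sum>\<sigma>\<in>Poly_Mapping.keys a. \<Sum>v | v \<in> \<sigma> \<and> b v \<and> \<sigma> - {v} \<in> K.
        Poly_Mapping.single (\<sigma> - {v}) (Poly_Mapping.lookup a \<sigma>))"

definition cycle_group ::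
    "'x set set \<Rightarrow> ('x \<Rightarrow> bool) \<Rightarrow> int \<Rightarrow> ('x set \<Rightarrow>\<^sub>0 bit) monoid" where
  "cycle_group K b n =
     (chain_group K n)\<lparr>carrier := {a \<in> carrier (chain_group K n). differential K b a = 0}\<rparr>"

text \<open>Homology is given by its additive groups. Over the field with two elements, an additive map
  between vector spaces is linear, so a group isomorphism is an isomorphism of vector spaces.\<close>

definition homology ::
    "'x set set \<Rightarrow> ('x \<Rightarrow> bool) \<Rightarrow> int \<Rightarrow> ('x set \<Rightarrow>\<^sub>0 bit) set monoid" where
  "homology K b n =
     cycle_group K b n Mod (differential K b ` carrier (chain_group K (n + 1)))"

definition simplicial_homology :: "'x set set \<Rightarrow> int \<Rightarrow> ('x set \<Rightarrow>\<^sub>0 bit) set monoid" where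
  "simplicial_homology X n = homology X (\<lambda>_. True) n"

definition reduced_homology :: "'x set set \<Rightarrow> int \<Rightarrow> ('x set \<Rightarrow>\<^sub>0 bit) set monoid" where
  "reduced_homology X n = homology (insert {} X) (\<lambda>_. True) n"

datatype colour = Black | White

definition weight :: "('x \<Rightarrow> colour) \<Rightarrow> 'x set \<Rightarrow> nat" where
  "weight \<epsilon> \<sigma> = card {v \<in> \<sigma>. \<epsilon> v = White}"

definition horizontal_homology ::
    "'x set set \<Rightarrow> ('x \<Rightarrow> colour) \<Rightarrow> nat \<Rightarrow> int \<Rightarrow> ('x set \<Rightarrow>\<^sub>0 bit) set monoid" where
  "horizontal_homology X \<epsilon> k n = homology {\<sigma> \<in> X. weight \<epsilon> \<sigma> = k} (\<lambda>v. \<epsilon> v = Black) n"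

text \<open>The degree \<open>n\<close> part of a copy of the field with two elements placed in degree \<open>d\<close>.\<close>

definition F_in_degree :: "int \<Rightarrow> int \<Rightarrow> bit monoid" where
  "F_in_degree d n = \<lparr>carrier = (if n = d then UNIV else {0}), mult = (+), one = 0\<rparr>"

section \<open>Plane graphs and their duals\<close>

text \<open>The plane is the complex plane. The edge \<open>e\<close> is drawn as the image of \<open>curve G e\<close>; the
  orientation that this curve gives to \<open>e\<close> plays no role except to name the two half-edges of \<open>e\<close>.\<close>

record 'e plane_graph = "(complex, 'e) graph" +
  curve :: "'e \<Rightarrow> real \<Rightarrow> complex"

definition drawing :: "'e plane_graph \<Rightarrow> complex set" where
  "drawing G = verts G \<union> (\<Union>e\<in>edges G. path_image (curve G e))"

definition finite_plane_graph :: "'e plane_graph \<Rightarrow> bool" where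
  "finite_plane_graph G \<longleftrightarrow>
     finite (verts G) \<and> finite (edges G) \<and>
     (\<forall>e\<in>edges G. simple_path (curve G e) \<and>
        ends G e = {pathstart (curve G e), pathfinish (curve G e)} \<and>
        ends G e \<subseteq> verts G \<and>
        curve G e ` {0<..<1} \<inter> verts G = {}) \<and>
     (\<forall>e\<in>edges G. \<forall>f\<in>edges G. e \<noteq> f \<longrightarrow>
        path_image (curve G e) \<inter> path_image (curve G f) \<subseteq> verts G)"

text \<open>Near \<open>p\<close>, up to homeomorphism, \<open>A\<close> and \<open>B\<close> are the two coordinate axes.\<close>

definition crosses_at :: "complex set \<Rightarrow> complex set \<Rightarrow> complex \<Rightarrow> bool" where
  "crosses_at A B p \<longleftrightarrow>
     (\<exists>U h h'. open U \<and> p \<in> U \<and> homeomorphism U (ball 0 1) h h' \<and> h p = 0 \<and>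
        h ` (U \<inter> A) = {z \<in> ball 0 1. Im z = 0} \<and>
        h ` (U \<inter> B) = {z \<in> ball 0 1. Re z = 0})"

text \<open>The dual edge of \<open>e\<close> carries the same label \<open>e\<close>, and \<open>c e\<close> is their crossing point.\<close>

definition plane_dual :: "'e plane_graph \<Rightarrow> 'e plane_graph \<Rightarrow> ('e \<Rightarrow> complex) \<Rightarrow> bool" where
  "plane_dual G D c \<longleftrightarrow>
     finite_plane_graph D \<and> edges D = edges G \<and>
     verts D \<inter> drawing G = {} \<and>
     (\<forall>F\<in>components (- drawing G). \<exists>!v. v \<in> verts D \<and> v \<in> F) \<and>
     (\<forall>e\<in>edges G.
        c e \<notin> verts G \<and>
        c e \<in> path_image (curve G e) \<and>
        path_image (curve D e) \<inter> drawing G = {c e} \<and>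
        crosses_at (path_image (curve G e)) (path_image (curve D e)) (c e))"

section \<open>The overlaid Tait graph\<close>

text \<open>The barycentric subdivision of \<open>G\<close>, with barycentre \<open>c e\<close> on the edge \<open>e\<close>. The half-edge
  \<open>(e, False)\<close> joins \<open>c e\<close> to the start of the curve of \<open>e\<close> and \<open>(e, True)\<close> joins it to the end, so
  that a loop has two half-edges as well.\<close>

definition barycentric :: "('e \<Rightarrow> complex) \<Rightarrow> 'e plane_graph \<Rightarrow> (complex, 'e \<times> bool) graph" where
  "barycentric c G =
     \<lparr>verts = verts G \<union> c ` edges G,
      edges = edges G \<times> UNIV,
      ends = (\<lambda>(e, s). {c e, if s then pathfinish (curve G e) else pathstart (curve G e)})\<rparr>"

definition overlaid_Tait ::
    "'e plane_graph \<Rightarrow> 'e plane_graph \<Rightarrow> ('e \<Rightarrow> complex) \<Rightarrow>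
      (complex, 'e \<times> bool + 'e \<times> bool) graph" where
  "overlaid_Tait G D c =
     \<lparr>verts = verts G \<union> verts D \<union> c ` edges G,
      edges = edges (barycentric c G) <+> edges (barycentric c D),
      ends = case_sum (ends (barycentric c G)) (ends (barycentric c D))\<rparr>"

text \<open>If \<open>D\<close> is a plane dual of \<open>G\<close>, then every edge of the overlaid Tait graph has an endpoint in
  exactly one of \<open>verts G\<close> and \<open>verts D\<close>.\<close>

definition Tait_colouring ::
    "'e plane_graph \<Rightarrow> 'e plane_graph \<Rightarrow> ('e \<Rightarrow> complex) \<Rightarrow> 'e \<times> bool + 'e \<times> bool \<Rightarrow> colour" where
  "Tait_colouring G D c x =
     (if ends (overlaid_Tait G D c) x \<inter> verts G \<noteq> {} then Black else White)"

text \<open>The subgraph \<open>G(\<mu>)\<close>, for a matching \<open>\<mu>\<close> of the barycentric subdivision of the dual \<open>D\<close>.\<close>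

definition delete_covered ::
    "'e plane_graph \<Rightarrow> 'e plane_graph \<Rightarrow> ('e \<Rightarrow> complex) \<Rightarrow> ('e \<times> bool) set \<Rightarrow> 'e plane_graph" where
  "delete_covered G D c \<mu> =
     G\<lparr>edges := {e \<in> edges G. c e \<notin> (\<Union>x\<in>\<mu>. ends (barycentric c D) x)}\<rparr>"

end

theory Submission
  imports Defs
begin

text \<open>A matching of the overlaid Tait graph is a disjoint union of a matching \<open>\<mu>\<close> of the barycentric
  subdivision of the dual and a matching \<open>A\<close> of the barycentric subdivision of \<open>G\<close> that avoids the
  crossing points covered by \<open>\<mu>\<close>, which means that \<open>A\<close> is a matching of the subdivision of \<open>G(\<mu>)\<close>. The
  horizontal differential only changes \<open>A\<close>, so the complex of weight \<open>k\<close> is the direct sum over \<open>\<mu>\<close>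
  with \<open>k\<close> edges of the chain complexes of the matching complexes of the subdivided \<open>G(\<mu>)\<close>, shifted by \<open>k\<close>.
  For \<open>k > 0\<close> the choice \<open>A = {}\<close> is allowed, so these complexes are augmented, and each \<open>\<mu>\<close> with
  \<open>G(\<mu>)\<close> empty contributes only the augmentation class; for \<open>k = 0\<close> it is excluded.\<close>

section \<open>Direct sums of groups\<close>

text \<open>This is the first isomorphism theorem for the map sending \<open>a\<close> to the family
  of cosets of the \<open>p i a\<close>. The joint surjectivity \<open>surj\<close> makes it onto,
  and the componentwise description of \<open>M\<close> identifies \<open>M\<close> with its kernel.
  In the application \<open>G\<close> consists of cycles, \<open>M\<close> of boundaries, and
  \<open>p\<close> of the projections to the summands.\<close>

lemma FactGroup_sum_group_iso:
  fixes G :: "('a, 'm) monoid_scheme" and H :: "'i \<Rightarrow> ('b, 'n) monoid_scheme"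
  assumes G: "group G" and I: "finite I"
    and N: "\<And>i. i \<in> I \<Longrightarrow> N i \<lhd> H i"
    and p: "\<And>i. i \<in> I \<Longrightarrow> p i \<in> hom G (H i)"
    and surj: "\<And>z. (\<And>i. i \<in> I \<Longrightarrow> z i \<in> carrier (H i)) \<Longrightarrow> \<exists>a\<in>carrier G. \<forall>i\<in>I. p i a = z i"
    and M: "M \<subseteq> carrier G" "\<And>a. a \<in> carrier G \<Longrightarrow> a \<in> M \<longleftrightarrow> (\<forall>i\<in>I. p i a \<in> N i)"
  shows "G Mod M \<cong> sum_group I (\<lambda>i. H i Mod N i)"
proof -
  let ?S = "sum_group I (\<lambda>i. H i Mod N i)"
  define h where "h a = (\<lambda>i\<in>I. N i #>\<^bsub>H i\<^esub> p i a)" for a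
  have gr: "group (H i Mod N i)" if "i \<in> I" for i
    using N[OF that] by (rule normal.factorgroup_is_group)
  \<comment> \<open>Since \<open>I\<close> is finite, the direct sum is the full product, so no
    support condition has to be checked.\<close>
  have car: "carrier ?S = (\<Pi>\<^sub>E i\<in>I. carrier (H i Mod N i))"
    using I by (subst carrier_sum_group) (auto simp: gr)
  have pc: "p i a \<in> carrier (H i)" if "i \<in> I" "a \<in> carrier G" for i a
    using p that by (auto simp: hom_def)
  have hom: "h \<in> hom G ?S"
  proof (rule homI)
    show "h a \<in> carrier ?S" if "a \<in> carrier G" for a
      using pc that unfolding car h_def by (auto simp: carrier_FactGroup)
    show "h (x \<otimes>\<^bsub>G\<^esub> y) = h x \<otimes>\<^bsub>?S\<^esub> h y" if "x \<in> carrier G" "y \<in> carrier G" for x y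
      using that by (auto simp: h_def fun_eq_iff hom_mult[OF p] normal.rcos_sum[OF N] pc)
  qed
  interpret h: group_hom G ?S h
    using G hom gr by (simp add: group_hom_def group_hom_axioms_def)
  have "kernel G ?S h = M"
  proof -
    have "h a = \<one>\<^bsub>?S\<^esub> \<longleftrightarrow> a \<in> M" if a: "a \<in> carrier G" for a
    proof -
      have "N i #>\<^bsub>H i\<^esub> p i a = N i \<longleftrightarrow> p i a \<in> N i" if i: "i \<in> I" for i
      proof -
        interpret normal "N i" "H i" using N i .
        show ?thesis
          using pc[OF i a] coset_join1 coset_join2 is_subgroup subset by blast
      qed
      then show ?thesis
        using M(2)[OF a] by (auto simp: h_def fun_eq_iff)
    qed
    then show ?thesis using M(1) by (auto simp: kernel_def)
  qed
  moreover have "h ` carrier G = carrier ?S"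
  proof
    show "h ` carrier G \<subseteq> carrier ?S" by auto
    show "carrier ?S \<subseteq> h ` carrier G"
    proof
      fix f assume f: "f \<in> carrier ?S"
      then have "\<forall>i\<in>I. \<exists>z. z \<in> carrier (H i) \<and> f i = N i #>\<^bsub>H i\<^esub> z"
        unfolding car by (force simp: carrier_FactGroup dest: PiE_mem)
      then obtain z where z: "\<And>i. i \<in> I \<Longrightarrow> z i \<in> carrier (H i)"
        "\<And>i. i \<in> I \<Longrightarrow> f i = N i #>\<^bsub>H i\<^esub> z i" by metis
      obtain a where a: "a \<in> carrier G" "\<forall>i\<in>I. p i a = z i" using surj[of z] z(1) by blast
      have "h a = f"
        using a z f unfolding car h_def by (auto simp: fun_eq_iff PiE_def extensional_def)
      then show "f \<in> h ` carrier G" using a by blast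
    qed
  qed
  ultimately show ?thesis using h.FactGroup_iso by simp
qed

lemma sum_group_split_iso:
  assumes fin: "finite I" "finite J" and disj: "I \<inter> J = {}"
    and G: "\<And>i. i \<in> I \<union> J \<Longrightarrow> group (G i)"
  shows "sum_group (I \<union> J) G \<cong> sum_group I G \<times>\<times> sum_group J G"
proof -
  let ?h = "\<lambda>f. (restrict f I, restrict f J)"
  have car: "carrier (sum_group K G) = (\<Pi>\<^sub>E i\<in>K. carrier (G i))" if "K \<subseteq> I \<union> J" for K
    using finite_subset[OF that] fin by (subst carrier_sum_group) (use G that in auto)
  have "?h \<in> iso (sum_group (I \<union> J) G) (sum_group I G \<times>\<times> sum_group J G)"
  proof (rule isoI)
    show "?h \<in> hom (sum_group (I \<union> J) G) (sum_group I G \<times>\<times> sum_group J G)"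
      by (rule homI) (auto simp: car fun_eq_iff)
    show "bij_betw ?h (carrier (sum_group (I \<union> J) G)) (carrier (sum_group I G \<times>\<times> sum_group J G))"
    \<comment> \<open>The inverse glues two families along \<open>I\<close> and \<open>J\<close>;
      disjointness ensures that the else branch is taken on all of \<open>J\<close>.\<close>
    proof (rule bij_betw_byWitness[where f' = "\<lambda>(f, g). \<lambda>i\<in>I \<union> J. if i \<in> I then f i else g i"])
    qed (use disj in \<open>auto simp: car fun_eq_iff PiE_iff extensional_def\<close>)
  qed
  then show ?thesis by (rule is_isoI)
qed

lemma sum_group_singleton_iso:
  assumes "group (G i)"
  shows "sum_group {i} G \<cong> G i"
proof -
  have car: "carrier (sum_group {i} G) = (\<Pi>\<^sub>E i\<in>{i}. carrier (G i))"
    by (subst carrier_sum_group) (use assms in auto)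
  have "(\<lambda>f. f i) \<in> iso (sum_group {i} G) (G i)"
  proof (rule isoI)
    show "(\<lambda>f. f i) \<in> hom (sum_group {i} G) (G i)"
      by (rule homI) (auto simp: car)
    show "bij_betw (\<lambda>f. f i) (carrier (sum_group {i} G)) (carrier (G i))"
      by (rule bij_betw_byWitness[where f' = "\<lambda>x. \<lambda>j\<in>{i}. x"])
        (auto simp: car fun_eq_iff PiE_iff extensional_def split: if_splits)
  qed
  then show ?thesis by (rule is_isoI)
qed

section \<open>Chain complexes over the field with two elements\<close>

lemma comm_group_additive:
  fixes S :: "'a::ab_group_add set"
  assumes "0 \<in> S" "\<And>x y. x \<in> S \<Longrightarrow> y \<in> S \<Longrightarrow> x + y \<in> S" "\<And>x. x \<in> S \<Longrightarrow> - x \<in> S"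
  shows "comm_group \<lparr>carrier = S, mult = (+), one = 0\<rparr>"
proof (rule comm_groupI)
  fix x assume "x \<in> carrier \<lparr>carrier = S, mult = (+), one = 0\<rparr>"
  then show "\<exists>y\<in>carrier \<lparr>carrier = S, mult = (+), one = 0\<rparr>.
      y \<otimes>\<^bsub>\<lparr>carrier = S, mult = (+), one = 0\<rparr>\<^esub> x = \<one>\<^bsub>\<lparr>carrier = S, mult = (+), one = 0\<rparr>\<^esub>"
    using assms(3) by (intro bexI[of _ "- x"]) auto
qed (use assms in \<open>auto simp: add_ac\<close>)

text \<open>The definition sums over the keys of \<open>a\<close>, a range that varies with
  \<open>a\<close>. Indexing instead by the vertices that can be added to \<tau> gives a range
  independent of \<open>a\<close>, so additivity and the vanishing of the square can be read off
  coefficientwise.\<close>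

lemma lookup_differential:
  assumes "finite V" and a: "Poly_Mapping.keys a \<subseteq> Pow V"
  shows "Poly_Mapping.lookup (differential K b a) \<tau> =
    (if \<tau> \<in> K then \<Sum>v | v \<in> V \<and> v \<notin> \<tau> \<and> b v. Poly_Mapping.lookup a (insert v \<tau>) else 0)"
proof -
  let ?a = "Poly_Mapping.lookup a" and ?F = "\<lambda>\<sigma>. {v. v \<in> \<sigma> \<and> b v \<and> \<sigma> - {v} \<in> K}"
  let ?S = "{v. v \<in> V \<and> v \<notin> \<tau> \<and> b v}"
  have L: "Poly_Mapping.lookup (differential K b a) \<tau> =
      (\<Sum>\<sigma>\<in>Poly_Mapping.keys a. \<Sum>v\<in>?F \<sigma>. if \<sigma> - {v} = \<tau> then ?a \<sigma> else 0)"
    by (simp add: differential_def lookup_sum lookup_single when_def)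
  show ?thesis
  proof (cases "\<tau> \<in> K")
    case False
    then show ?thesis unfolding L by (auto intro!: sum.neutral)
  next
    case True
    have "(\<Sum>v\<in>?F \<sigma>. if \<sigma> - {v} = \<tau> then ?a \<sigma> else 0) = (\<Sum>v\<in>?S. if \<sigma> = insert v \<tau> then ?a \<sigma> else 0)"
      if "\<sigma> \<in> Poly_Mapping.keys a" for \<sigma>
    proof -
      have sub: "\<sigma> \<subseteq> V" using a that by auto
      \<comment> \<open>Both inner sums are extended by zeros to the index set \<open>V\<close>.
        There, deleting \<open>v\<close> from \<sigma> to reach \<tau> and adding a new
        \<open>v\<close> to \<tau> to reach \<sigma> are the same condition.\<close>
      have "(\<Sum>v\<in>?F \<sigma>. if \<sigma> - {v} = \<tau> then ?a \<sigma> else 0)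
          = (\<Sum>v\<in>V. if v \<in> ?F \<sigma> \<and> \<sigma> - {v} = \<tau> then ?a \<sigma> else 0)"
        by (rule sum.mono_neutral_cong_left) (use \<open>finite V\<close> sub in auto)
      also have "\<dots> = (\<Sum>v\<in>V. if v \<in> ?S \<and> \<sigma> = insert v \<tau> then ?a \<sigma> else 0)"
        by (rule sum.cong) (use True in \<open>auto simp: insert_absorb\<close>)
      also have "\<dots> = (\<Sum>v\<in>?S. if \<sigma> = insert v \<tau> then ?a \<sigma> else 0)"
        by (rule sum.mono_neutral_cong_right) (use \<open>finite V\<close> in auto)
      finally show ?thesis .
    qed
    then have "Poly_Mapping.lookup (differential K b a) \<tau> =
        (\<Sum>\<sigma>\<in>Poly_Mapping.keys a. \<Sum>v\<in>?S. if \<sigma> = insert v \<tau> then ?a \<sigma> else 0)"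
      unfolding L by (rule sum.cong[OF refl])
    also have "\<dots> = (\<Sum>v\<in>?S. \<Sum>\<sigma>\<in>Poly_Mapping.keys a. if \<sigma> = insert v \<tau> then ?a \<sigma> else 0)"
      by (rule sum.swap)
    \<comment> \<open>For fixed \<open>v\<close> only the term of \<open>insert v \<tau>\<close>
      survives; if that set is not a key, its coefficient is 0 and the formula still holds.\<close>
    also have "\<dots> = (\<Sum>v\<in>?S. ?a (insert v \<tau>))"
      by (rule sum.cong) (auto simp: sum.delta' in_keys_iff)
    finally show ?thesis using True by simp
  qed
qed

text \<open>The terms off the diagonal come in equal pairs, which cancel in characteristic
  two.\<close>

lemma sum_symmetric_bit:
  fixes f :: "'a \<Rightarrow> 'a \<Rightarrow> bit"
  assumes "finite S" "\<And>v w. f v w = f w v" "\<And>v. f v v = 0"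
  shows "(\<Sum>v\<in>S. \<Sum>w\<in>S. f v w) = 0"
  using assms(1)
proof (induction S)
  case (insert x S)
  have "(\<Sum>v\<in>insert x S. \<Sum>w\<in>insert x S. f v w)
      = (\<Sum>w\<in>S. f x w) + ((\<Sum>v\<in>S. f v x) + (\<Sum>v\<in>S. \<Sum>w\<in>S. f v w))"
    using insert.hyps assms(3) by (simp del: add_bit_eq_xor add: sum.distrib)
  also have "\<dots> = (\<Sum>w\<in>S. f x w) + (\<Sum>w\<in>S. f x w)"
    using insert.IH assms(2)[of _ x] by (simp del: add_bit_eq_xor)
  also have "\<dots> = 0" by (cases "\<Sum>w\<in>S. f x w") simp_all
  finally show ?case .
qed simp

text \<open>Convexity of \<open>K\<close> replaces closure under subsets: whenever \<open>\<tau>\<close> and \<open>\<tau> \<union> {v, w}\<close> are generators, so are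
  both intermediate sets, and the two ways to delete \<open>v\<close> and \<open>w\<close> cancel.\<close>

lemma differential_differential:
  assumes V: "finite V" and K: "K \<subseteq> Pow V"
    and convex: "\<And>\<rho> \<sigma> \<tau>. \<rho> \<in> K \<Longrightarrow> \<tau> \<in> K \<Longrightarrow> \<rho> \<subseteq> \<sigma> \<Longrightarrow> \<sigma> \<subseteq> \<tau> \<Longrightarrow> \<sigma> \<in> K"
    and a: "Poly_Mapping.keys a \<subseteq> K"
  shows "differential K b (differential K b a) = 0"
proof (rule poly_mapping_eqI)
  fix \<tau>
  have aV: "Poly_Mapping.keys a \<subseteq> Pow V" using a K by blast
  have dV: "Poly_Mapping.keys (differential K b a) \<subseteq> Pow V"
    using K by (auto simp: in_keys_iff lookup_differential[OF V aV] split: if_splits)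
  let ?S = "{v. v \<in> V \<and> v \<notin> \<tau> \<and> b v}"
  \<comment> \<open>The diagonal is set to 0 because adding the same vertex twice does not
    correspond to a double deletion. This makes \<open>f\<close> a symmetric function on a full
    square of indices.\<close>
  define f where "f v w = (if v = w then 0 else Poly_Mapping.lookup a (insert w (insert v \<tau>)))" for v w
  have "Poly_Mapping.lookup (differential K b a) (insert v \<tau>) = (\<Sum>w\<in>?S. f v w)"
    if \<tau>: "\<tau> \<in> K" for v
  proof (cases "insert v \<tau> \<in> K")
    case True
    have "(\<Sum>w | w \<in> V \<and> w \<notin> insert v \<tau> \<and> b w. Poly_Mapping.lookup a (insert w (insert v \<tau>)))
      = (\<Sum>w\<in>?S. f v w)"
      by (rule sum.mono_neutral_cong_left) (use V in \<open>auto simp: f_def\<close>)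
    then show ?thesis using True by (simp add: lookup_differential[OF V aV])
  next
    case False
    then have "insert w (insert v \<tau>) \<notin> Poly_Mapping.keys a" for w
      using convex[OF \<tau>, of "insert w (insert v \<tau>)" "insert v \<tau>"] a by blast
    then show ?thesis
      using False by (simp add: lookup_differential[OF V aV] f_def in_keys_iff sum.neutral)
  qed
  moreover have "(\<Sum>v\<in>?S. \<Sum>w\<in>?S. f v w) = 0"
    by (rule sum_symmetric_bit) (use V in \<open>auto simp: f_def insert_commute\<close>)
  ultimately show "Poly_Mapping.lookup (differential K b (differential K b a)) \<tau> = Poly_Mapping.lookup 0 \<tau>"
    by (simp add: lookup_differential[OF V dV])
qed

lemma differential_add:
  assumes "finite V" "Poly_Mapping.keys x \<subseteq> Pow V" "Poly_Mapping.keys y \<subseteq> Pow V"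
  shows "differential K b (x + y) = differential K b x + differential K b y"
proof -
  have "Poly_Mapping.keys (x + y) \<subseteq> Pow V"
    using Poly_Mapping.keys_add[of x y] assms(2,3) by blast
  then show ?thesis
    using assms
    by (intro poly_mapping_eqI)
      (simp del: add_bit_eq_xor add: lookup_add lookup_differential sum.distrib)
qed

section \<open>Cycles, boundaries and the homology groups\<close>

lemma uminus_bit_poly_mapping: "- a = (a :: 'a \<Rightarrow>\<^sub>0 bit)"
  by (rule poly_mapping_eqI) simp

lemma differential_0 [simp]: "differential K b 0 = 0"
  by (simp add: differential_def)

lemma carrier_chain_group:
  "carrier (chain_group K n) = {a. Poly_Mapping.keys a \<subseteq> {\<sigma> \<in> K. int (card \<sigma>) = n + 1}}"
  by (simp add: chain_group_def)

lemma chain_group_keysD: "a \<in> carrier (chain_group K n) \<Longrightarrow> Poly_Mapping.keys a \<subseteq> K"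
  by (auto simp: carrier_chain_group)

lemma cycle_group_simps:
  "carrier (cycle_group K b n) = {a \<in> carrier (chain_group K n). differential K b a = 0}"
  "mult (cycle_group K b n) = (+)" "one (cycle_group K b n) = 0"
  by (simp_all add: cycle_group_def chain_group_def)

lemma cycle_group_eq:
  "cycle_group K b n = \<lparr>carrier = {a \<in> carrier (chain_group K n). differential K b a = 0}, mult = (+), one = 0\<rparr>"
  by (simp add: cycle_group_def chain_group_def)

lemma chain_group_closed:
  "0 \<in> carrier (chain_group K n)"
  "x \<in> carrier (chain_group K n) \<Longrightarrow> y \<in> carrier (chain_group K n) \<Longrightarrow> x + y \<in> carrier (chain_group K n)"
  using Poly_Mapping.keys_add[of x y] by (auto simp: carrier_chain_group)

lemma comm_group_cycle_group:
  assumes "finite V" "K \<subseteq> Pow V"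
  shows "comm_group (cycle_group K b n)"
  unfolding cycle_group_eq
proof (rule comm_group_additive)
  fix x y
  assume xy: "x \<in> {a \<in> carrier (chain_group K n). differential K b a = 0}"
    "y \<in> {a \<in> carrier (chain_group K n). differential K b a = 0}"
  then have "Poly_Mapping.keys x \<subseteq> Pow V" "Poly_Mapping.keys y \<subseteq> Pow V"
    using assms chain_group_keysD by blast+
  then show "x + y \<in> {a \<in> carrier (chain_group K n). differential K b a = 0}"
    using xy by (simp add: chain_group_closed differential_add[OF assms(1)])
qed (auto simp: chain_group_closed uminus_bit_poly_mapping)

text \<open>A nonzero coefficient at \<tau> needs a key of \<open>a\<close> with exactly one vertex
  more than \<tau>. Finiteness of \<tau> matters here, since \<open>card\<close> is 0 on infinite
  sets.\<close>

lemma differential_in_chain_group: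
  assumes V: "finite V" "K \<subseteq> Pow V" and a: "a \<in> carrier (chain_group K (n + 1))"
  shows "differential K b a \<in> carrier (chain_group K n)"
proof -
  have aV: "Poly_Mapping.keys a \<subseteq> Pow V" using V(2) chain_group_keysD[OF a] by blast
  have "\<tau> \<in> K \<and> int (card \<tau>) = n + 1" if "\<tau> \<in> Poly_Mapping.keys (differential K b a)" for \<tau>
  proof -
    have "\<tau> \<in> K" and "(\<Sum>v | v \<in> V \<and> v \<notin> \<tau> \<and> b v. Poly_Mapping.lookup a (insert v \<tau>)) \<noteq> 0"
      using that by (simp_all add: in_keys_iff lookup_differential[OF V(1) aV] split: if_splits)
    then obtain v where "v \<notin> \<tau>" "insert v \<tau> \<in> Poly_Mapping.keys a"
      by (metis (mono_tags, lifting) in_keys_iff mem_Collect_eq sum.neutral)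
    moreover have "finite \<tau>" using \<open>\<tau> \<in> K\<close> V finite_subset by blast
    ultimately show ?thesis using a \<open>\<tau> \<in> K\<close> by (auto simp: carrier_chain_group)
  qed
  then show ?thesis by (auto simp: carrier_chain_group)
qed

text \<open>Convexity makes the differential square to zero, so boundaries are cycles. The cycle
  group is abelian, hence being a subgroup suffices.\<close>

lemma boundaries_normal:
  assumes V: "finite V" "K \<subseteq> Pow V"
    and convex: "\<And>\<rho> \<sigma> \<tau>. \<rho> \<in> K \<Longrightarrow> \<tau> \<in> K \<Longrightarrow> \<rho> \<subseteq> \<sigma> \<Longrightarrow> \<sigma> \<subseteq> \<tau> \<Longrightarrow> \<sigma> \<in> K"
  shows "differential K b ` carrier (chain_group K (n + 1)) \<lhd> cycle_group K b n"
proof -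
  interpret Z: comm_group "cycle_group K b n" using V by (rule comm_group_cycle_group)
  let ?B = "differential K b ` carrier (chain_group K (n + 1))"
  have sub: "?B \<subseteq> carrier (cycle_group K b n)"
    using differential_in_chain_group[OF V]
      differential_differential[OF V convex chain_group_keysD] by (auto simp: cycle_group_simps)
  have kV: "Poly_Mapping.keys x \<subseteq> Pow V" if "x \<in> carrier (chain_group K (n + 1))" for x
    using V(2) chain_group_keysD[OF that] by blast
  \<comment> \<open>In characteristic two every element is its own inverse.\<close>
  have inv: "inv\<^bsub>cycle_group K b n\<^esub> x = x" if "x \<in> carrier (cycle_group K b n)" for x
  proof (rule Z.inv_equality)
    show "x \<otimes>\<^bsub>cycle_group K b n\<^esub> x = \<one>\<^bsub>cycle_group K b n\<^esub>"
      using add.right_inverse[of x] by (simp add: cycle_group_simps uminus_bit_poly_mapping)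
  qed (use that in auto)
  have "subgroup ?B (cycle_group K b n)"
  proof (rule Z.subgroupI)
    show "?B \<noteq> {}" using chain_group_closed(1) by blast
    show "inv\<^bsub>cycle_group K b n\<^esub> x \<in> ?B" if "x \<in> ?B" for x
      using that inv[OF subsetD[OF sub that]] by simp
    show "x \<otimes>\<^bsub>cycle_group K b n\<^esub> y \<in> ?B" if "x \<in> ?B" "y \<in> ?B" for x y
    proof -
      obtain s t where "s \<in> carrier (chain_group K (n + 1))" "x = differential K b s"
        "t \<in> carrier (chain_group K (n + 1))" "y = differential K b t" using \<open>x \<in> ?B\<close> \<open>y \<in> ?B\<close> by blast
      then have "x + y = differential K b (s + t)" "s + t \<in> carrier (chain_group K (n + 1))"
        using differential_add[OF V(1) kV kV] chain_group_closed(2) by auto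
      then show ?thesis by (simp add: cycle_group_simps)
    qed
  qed (rule sub)
  then show ?thesis by (rule Z.normal_iff_subgroup[THEN iffD2])
qed

lemma group_homology:
  assumes "finite V" "K \<subseteq> Pow V"
    and "\<And>\<rho> \<sigma> \<tau>. \<rho> \<in> K \<Longrightarrow> \<tau> \<in> K \<Longrightarrow> \<rho> \<subseteq> \<sigma> \<Longrightarrow> \<sigma> \<subseteq> \<tau> \<Longrightarrow> \<sigma> \<in> K"
  shows "group (homology K b n)"
  unfolding homology_def
  by (rule normal.factorgroup_is_group, rule boundaries_normal[OF assms(1,2)]) (rule assms(3))

section \<open>Splitting a complex along vertices that the differential never deletes\<close>

text \<open>Only left vertices are deleted, so every face of \<open>A <+> \<mu>\<close> in the
  differential keeps the same \<mu>, and the complex is a direct sum of blocks indexed by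
  \<open>I\<close>. Each \<mu> has \<open>k\<close> elements, which shifts the degree by
  \<open>k\<close>. The block projections are chain maps and jointly bijective on chains, hence
  cycles and boundaries are detected block by block.\<close>

lemma homology_Plus_iso:
  fixes K :: "'y set \<Rightarrow> 'x set set" and b :: "'x + 'y \<Rightarrow> bool"
  assumes V: "finite V" and I: "finite I" "\<And>\<mu>. \<mu> \<in> I \<Longrightarrow> finite \<mu> \<and> card \<mu> = k"
    and K: "\<And>\<mu>. \<mu> \<in> I \<Longrightarrow> K \<mu> \<subseteq> Pow V"
    and convex: "\<And>\<mu> \<rho> \<sigma> \<tau>. \<mu> \<in> I \<Longrightarrow> \<rho> \<in> K \<mu> \<Longrightarrow> \<tau> \<in> K \<mu> \<Longrightarrow> \<rho> \<subseteq> \<sigma> \<Longrightarrow> \<sigma> \<subseteq> \<tau> \<Longrightarrow> \<sigma> \<in> K \<mu>"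
    and b: "\<And>x. x \<in> V \<Longrightarrow> b (Inl x)" "\<And>\<mu> y. \<mu> \<in> I \<Longrightarrow> y \<in> \<mu> \<Longrightarrow> \<not> b (Inr y)"
  shows "homology (\<Union>\<mu>\<in>I. (\<lambda>A. A <+> \<mu>) ` K \<mu>) b n
    \<cong> sum_group I (\<lambda>\<mu>. homology (K \<mu>) (\<lambda>_. True) (n - int k))"
proof -
  define L where "L = (\<Union>\<mu>\<in>I. (\<lambda>A. A <+> \<mu>) ` K \<mu>)"
  define W where "W = V <+> \<Union>I"
  \<comment> \<open>The projection to the block of \<mu> pulls the coefficient function back along
    the injective map \<open>A \<mapsto> A <+> \<mu>\<close>.\<close>
  define \<pi> :: "'y set \<Rightarrow> (('x + 'y) set \<Rightarrow>\<^sub>0 bit) \<Rightarrow> 'x set \<Rightarrow>\<^sub>0 bit"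
    where "\<pi> \<mu> = Poly_Mapping.map_key (\<lambda>A. A <+> \<mu>)" for \<mu>
  have Plus_eq: "A <+> \<mu> = A' <+> \<mu>' \<longleftrightarrow> A = A' \<and> \<mu> = \<mu>'" for A A' :: "'x set" and \<mu> \<mu>' :: "'y set"
    by (auto simp: Plus_def)
  then have inj: "inj (\<lambda>A :: 'x set. A <+> \<mu>)" for \<mu> :: "'y set"
    by (auto simp: inj_def)
  have lookup_\<pi>: "Poly_Mapping.lookup (\<pi> \<mu> a) A = Poly_Mapping.lookup a (A <+> \<mu>)" for \<mu> a A
    by (simp add: \<pi>_def map_key.rep_eq[OF inj])
  have W: "finite W" "L \<subseteq> Pow W"
    using V I K by (fastforce simp: W_def L_def)+
  have LW: "Poly_Mapping.keys a \<subseteq> Pow W" if "Poly_Mapping.keys a \<subseteq> L" for a :: "('x + 'y) set \<Rightarrow>\<^sub>0 bit"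
    using W(2) that by blast
  have in_L: "A <+> \<mu> \<in> L \<longleftrightarrow> A \<in> K \<mu>" if "\<mu> \<in> I" for A \<mu>
    using that by (auto simp: L_def Plus_eq)
  have keys_\<pi>: "Poly_Mapping.keys (\<pi> \<mu> a) \<subseteq> K \<mu>" if "\<mu> \<in> I" "Poly_Mapping.keys a \<subseteq> L" for \<mu> a
  proof
    fix A assume "A \<in> Poly_Mapping.keys (\<pi> \<mu> a)"
    then have "A <+> \<mu> \<in> Poly_Mapping.keys a" by (simp add: in_keys_iff lookup_\<pi>)
    then show "A \<in> K \<mu>" using that in_L by blast
  qed
  have card_Plus': "int (card (A <+> \<mu>)) = int (card A) + int k" if "\<mu> \<in> I" "A \<in> K \<mu>" for A \<mu>
    using that I K[OF that(1)] V by (subst card_Plus) (auto intro: finite_subset)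
  have \<pi>_chain: "\<pi> \<mu> a \<in> carrier (chain_group (K \<mu>) (m - int k))"
    if \<mu>: "\<mu> \<in> I" and a: "a \<in> carrier (chain_group L m)" for \<mu> a m
  proof -
    have "int (card A) = m - int k + 1" if "A \<in> Poly_Mapping.keys (\<pi> \<mu> a)" for A
    proof -
      have "A <+> \<mu> \<in> Poly_Mapping.keys a" using that by (simp add: in_keys_iff lookup_\<pi>)
      then have "int (card (A <+> \<mu>)) = m + 1" using a by (auto simp: carrier_chain_group)
      then show ?thesis
        using card_Plus'[OF \<mu>, of A] keys_\<pi>[OF \<mu> chain_group_keysD[OF a]] that by auto
    qed
    then show ?thesis
      using keys_\<pi>[OF \<mu> chain_group_keysD[OF a]] by (auto simp: carrier_chain_group)
  qed
  have \<pi>_diff: "\<pi> \<mu> (differential L b a) = differential (K \<mu>) (\<lambda>_. True) (\<pi> \<mu> a)"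
    if \<mu>: "\<mu> \<in> I" and a: "Poly_Mapping.keys a \<subseteq> L" for \<mu> a
  proof (rule poly_mapping_eqI)
    fix A
    have "Poly_Mapping.keys (\<pi> \<mu> a) \<subseteq> Pow V" using keys_\<pi>[OF \<mu> a] K[OF \<mu>] by blast
    note d = lookup_differential[OF V this] lookup_differential[OF W(1) LW[OF a]]
    \<comment> \<open>The right vertices in \<open>W\<close> all lie in members of \<open>I\<close>
      and fail \<open>b\<close>, so the vertices that can be added are exactly those of the block's
      own differential.\<close>
    have "{w. w \<in> W \<and> w \<notin> A <+> \<mu> \<and> b w} = Inl ` {v. v \<in> V \<and> v \<notin> A}"
      using b \<mu> unfolding W_def by (auto simp: Plus_def)
    then have "(\<Sum>w | w \<in> W \<and> w \<notin> A <+> \<mu> \<and> b w. Poly_Mapping.lookup a (insert w (A <+> \<mu>)))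
        = (\<Sum>v | v \<in> V \<and> v \<notin> A. Poly_Mapping.lookup a (insert (Inl v) (A <+> \<mu>)))"
      by (simp add: sum.reindex)
    moreover have "insert (Inl v) (A <+> \<mu>) = insert v A <+> \<mu>" for v
      by (auto simp: Plus_def)
    ultimately show "Poly_Mapping.lookup (\<pi> \<mu> (differential L b a)) A =
        Poly_Mapping.lookup (differential (K \<mu>) (\<lambda>_. True) (\<pi> \<mu> a)) A"
      by (simp add: lookup_\<pi> d in_L[OF \<mu>])
  qed
  have \<pi>_inj: "x = y" if "Poly_Mapping.keys x \<subseteq> L" "Poly_Mapping.keys y \<subseteq> L" "\<And>\<mu>. \<mu> \<in> I \<Longrightarrow> \<pi> \<mu> x = \<pi> \<mu> y"
    for x y
  proof (rule poly_mapping_eqI)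
    fix \<sigma>
    show "Poly_Mapping.lookup x \<sigma> = Poly_Mapping.lookup y \<sigma>"
    proof (cases "\<sigma> \<in> L")
      case True
      then obtain \<mu> A where "\<mu> \<in> I" "\<sigma> = A <+> \<mu>" by (auto simp: L_def)
      then show ?thesis using that(3) lookup_\<pi> by metis
    next
      case False
      then have "\<sigma> \<notin> Poly_Mapping.keys x" "\<sigma> \<notin> Poly_Mapping.keys y" using that(1,2) by blast+
      then show ?thesis by (simp add: in_keys_iff)
    qed
  qed
  have \<pi>_surj: "\<exists>a\<in>carrier (chain_group L m). \<forall>\<mu>\<in>I. \<pi> \<mu> a = z \<mu>"
    if z: "\<And>\<mu>. \<mu> \<in> I \<Longrightarrow> z \<mu> \<in> carrier (chain_group (K \<mu>) (m - int k))" for z m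
  proof -
    \<comment> \<open>The chain with prescribed blocks: the right part of \<sigma> selects the
      block, the left part the generator in it, and sets outside all blocks get coefficient 0. Its
      support is finite because there are finitely many blocks.\<close>
    define f where "f \<sigma> = (if Inr -` \<sigma> \<in> I then Poly_Mapping.lookup (z (Inr -` \<sigma>)) (Inl -` \<sigma>) else 0)" for \<sigma>
    have Plus_vimage: "Inl -` \<sigma> <+> Inr -` \<sigma> = \<sigma>" for \<sigma> :: "('x + 'y) set"
    proof (rule Set.set_eqI)
      show "x \<in> Inl -` \<sigma> <+> Inr -` \<sigma> \<longleftrightarrow> x \<in> \<sigma>" for x by (cases x) auto
    qed
    have vimage: "Inl -` (A <+> \<mu>) = A" "Inr -` (A <+> \<mu>) = \<mu>" for A :: "'x set" and \<mu> :: "'y set"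
      by auto
    have "{\<sigma>. f \<sigma> \<noteq> 0} \<subseteq> (\<Union>\<mu>\<in>I. (\<lambda>A. A <+> \<mu>) ` Poly_Mapping.keys (z \<mu>))"
    proof
      fix \<sigma> assume "\<sigma> \<in> {\<sigma>. f \<sigma> \<noteq> 0}"
      then have "Inr -` \<sigma> \<in> I" "Inl -` \<sigma> \<in> Poly_Mapping.keys (z (Inr -` \<sigma>))"
        by (auto simp: f_def in_keys_iff split: if_splits)
      then show "\<sigma> \<in> (\<Union>\<mu>\<in>I. (\<lambda>A. A <+> \<mu>) ` Poly_Mapping.keys (z \<mu>))"
        using Plus_vimage[of \<sigma>] by blast
    qed
    moreover have "finite (\<Union>\<mu>\<in>I. (\<lambda>A. A <+> \<mu>) ` Poly_Mapping.keys (z \<mu>))"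
      using I(1) by simp
    ultimately have "finite {\<sigma>. f \<sigma> \<noteq> 0}" by (rule finite_subset)
    then have f: "Poly_Mapping.lookup (Abs_poly_mapping f) = f" by (rule lookup_Abs_poly_mapping)
    have "\<sigma> \<in> L \<and> int (card \<sigma>) = m + 1" if \<sigma>: "\<sigma> \<in> Poly_Mapping.keys (Abs_poly_mapping f)" for \<sigma>
    proof -
      have *: "Inr -` \<sigma> \<in> I" "Inl -` \<sigma> \<in> Poly_Mapping.keys (z (Inr -` \<sigma>))"
        using \<sigma> by (auto simp: f f_def in_keys_iff split: if_splits)
      then have "Inl -` \<sigma> \<in> K (Inr -` \<sigma>)" "int (card (Inl -` \<sigma>)) = m - int k + 1"
        using z[OF *(1)] by (auto simp: carrier_chain_group)
      then show ?thesis
        using in_L[OF *(1), of "Inl -` \<sigma>"] card_Plus'[OF *(1), of "Inl -` \<sigma>"] by (simp add: Plus_vimage)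
    qed
    then have "Abs_poly_mapping f \<in> carrier (chain_group L m)" by (auto simp: carrier_chain_group)
    moreover have "\<pi> \<mu> (Abs_poly_mapping f) = z \<mu>" if "\<mu> \<in> I" for \<mu>
      using that by (intro poly_mapping_eqI) (simp only: lookup_\<pi> f f_def vimage if_True)
    ultimately show ?thesis by blast
  qed
  have \<pi>0: "\<pi> \<mu> 0 = 0" for \<mu> by (rule poly_mapping_eqI) (simp add: lookup_\<pi>)
  have cycle_iff: "differential L b a = 0 \<longleftrightarrow> (\<forall>\<mu>\<in>I. differential (K \<mu>) (\<lambda>_. True) (\<pi> \<mu> a) = 0)"
    if a: "a \<in> carrier (chain_group L m)" for a m
  proof -
    \<comment> \<open>Writing the degree as a successor lets
      \<open>differential_in_chain_group\<close> place the differential of \<open>a\<close> in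
      degree \<open>m - 1\<close>.\<close>
    have "a \<in> carrier (chain_group L (m - 1 + 1))" using a by simp
    then have "Poly_Mapping.keys (differential L b a) \<subseteq> L"
      by (intro chain_group_keysD) (rule differential_in_chain_group[OF W])
    then show ?thesis
      using \<pi>_inj[of "differential L b a" 0] \<pi>_diff[OF _ chain_group_keysD[OF a]] \<pi>0 by auto
  qed
  let ?B = "\<lambda>\<mu>. differential (K \<mu>) (\<lambda>_. True) ` carrier (chain_group (K \<mu>) (n - int k + 1))"
  let ?Z = "\<lambda>\<mu>. cycle_group (K \<mu>) (\<lambda>_. True) (n - int k)"
  have shift: "n - int k + 1 = n + 1 - int k" by simp
  have boundary_iff: "a \<in> differential L b ` carrier (chain_group L (n + 1)) \<longleftrightarrow> (\<forall>\<mu>\<in>I. \<pi> \<mu> a \<in> ?B \<mu>)"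
    if a: "a \<in> carrier (chain_group L n)" for a
  proof
    assume "a \<in> differential L b ` carrier (chain_group L (n + 1))"
    then obtain x where x: "x \<in> carrier (chain_group L (n + 1))" "a = differential L b x" by blast
    then show "\<forall>\<mu>\<in>I. \<pi> \<mu> a \<in> ?B \<mu>"
      using \<pi>_chain[OF _ x(1)] \<pi>_diff[OF _ chain_group_keysD[OF x(1)]] by (auto simp: shift)
  next
    \<comment> \<open>For the converse, a preimage under the differential is chosen in each block;
      these are glued to one chain, whose differential agrees with \<open>a\<close> on every
      block.\<close>
    assume "\<forall>\<mu>\<in>I. \<pi> \<mu> a \<in> ?B \<mu>"
    then have "\<forall>\<mu>\<in>I. \<exists>z. z \<in> carrier (chain_group (K \<mu>) (n + 1 - int k)) \<and>
        \<pi> \<mu> a = differential (K \<mu>) (\<lambda>_. True) z" by (auto simp: shift)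
    then obtain z where z: "\<And>\<mu>. \<mu> \<in> I \<Longrightarrow> z \<mu> \<in> carrier (chain_group (K \<mu>) (n + 1 - int k))"
      "\<And>\<mu>. \<mu> \<in> I \<Longrightarrow> \<pi> \<mu> a = differential (K \<mu>) (\<lambda>_. True) (z \<mu>)" by metis
    obtain x where x: "x \<in> carrier (chain_group L (n + 1))" "\<forall>\<mu>\<in>I. \<pi> \<mu> x = z \<mu>"
      using \<pi>_surj[of z "n + 1"] z(1) by blast
    have "a = differential L b x"
    proof (rule \<pi>_inj)
      show "Poly_Mapping.keys a \<subseteq> L" using a by (rule chain_group_keysD)
      show "Poly_Mapping.keys (differential L b x) \<subseteq> L"
        using differential_in_chain_group[OF W x(1)] by (rule chain_group_keysD)
      show "\<pi> \<mu> a = \<pi> \<mu> (differential L b x)" if "\<mu> \<in> I" for \<mu>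
        using that z(2) x(2) \<pi>_diff[OF that chain_group_keysD[OF x(1)]] by simp
    qed
    then show "a \<in> differential L b ` carrier (chain_group L (n + 1))" using x(1) by blast
  qed
  have "cycle_group L b n Mod (differential L b ` carrier (chain_group L (n + 1)))
      \<cong> sum_group I (\<lambda>\<mu>. ?Z \<mu> Mod ?B \<mu>)"
  proof (rule FactGroup_sum_group_iso[where p = \<pi>])
    show "group (cycle_group L b n)"
      using comm_group_cycle_group[OF W] by (rule comm_group.axioms)
    show "finite I" by fact
    show normal: "?B \<mu> \<lhd> ?Z \<mu>" if "\<mu> \<in> I" for \<mu>
      by (rule boundaries_normal[OF V K[OF that]]) (rule convex[OF that])
    show "\<pi> \<mu> \<in> hom (cycle_group L b n) (?Z \<mu>)" if "\<mu> \<in> I" for \<mu>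
    proof (rule homI)
      show "\<pi> \<mu> a \<in> carrier (?Z \<mu>)" if "a \<in> carrier (cycle_group L b n)" for a
        using that \<pi>_chain[OF \<open>\<mu> \<in> I\<close>] cycle_iff \<open>\<mu> \<in> I\<close> by (auto simp: cycle_group_simps)
      show "\<pi> \<mu> (x \<otimes>\<^bsub>cycle_group L b n\<^esub> y) = \<pi> \<mu> x \<otimes>\<^bsub>?Z \<mu>\<^esub> \<pi> \<mu> y" for x y
        by (simp add: cycle_group_simps \<pi>_def map_key_plus[OF inj])
    qed
    show "\<exists>a\<in>carrier (cycle_group L b n). \<forall>\<mu>\<in>I. \<pi> \<mu> a = z \<mu>"
      if z: "\<And>\<mu>. \<mu> \<in> I \<Longrightarrow> z \<mu> \<in> carrier (?Z \<mu>)" for z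
    proof -
      obtain a where a: "a \<in> carrier (chain_group L n)" "\<forall>\<mu>\<in>I. \<pi> \<mu> a = z \<mu>"
        using \<pi>_surj[of z n] z by (auto simp: cycle_group_simps)
      then have "differential L b a = 0" using cycle_iff[OF a(1)] z by (auto simp: cycle_group_simps)
      then show ?thesis using a by (auto simp: cycle_group_simps)
    qed
    \<comment> \<open>Boundaries and cycles of \<open>L\<close> are both tested on blocks, so this
      inclusion is inherited from the blocks.\<close>
    show "differential L b ` carrier (chain_group L (n + 1)) \<subseteq> carrier (cycle_group L b n)"
    proof
      fix a assume a: "a \<in> differential L b ` carrier (chain_group L (n + 1))"
      then have aC: "a \<in> carrier (chain_group L n)" using differential_in_chain_group[OF W] by blast
      have "\<pi> \<mu> a \<in> carrier (?Z \<mu>)" if "\<mu> \<in> I" for \<mu>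
        using boundary_iff[OF aC] a that
          normal_imp_subgroup[OF normal[OF that], THEN subgroup.subset] by blast
      then show "a \<in> carrier (cycle_group L b n)"
        using aC cycle_iff[OF aC] by (simp add: cycle_group_simps)
    qed
    show "a \<in> differential L b ` carrier (chain_group L (n + 1)) \<longleftrightarrow> (\<forall>\<mu>\<in>I. \<pi> \<mu> a \<in> ?B \<mu>)"
      if "a \<in> carrier (cycle_group L b n)" for a
      using that boundary_iff by (simp add: cycle_group_simps)
  qed
  then show ?thesis by (simp add: homology_def L_def)
qed

section \<open>The complex generated by the empty simplex alone\<close>

lemma group_F_in_degree: "group (F_in_degree d n)"
  unfolding F_in_degree_def by (rule comm_group.axioms(2), rule comm_group_additive) auto

text \<open>The complex is one copy of the field in degree -1 with zero differential, so its
  homology is read off by the coefficient of the empty simplex.\<close>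

lemma homology_empty_simplex_iso: "homology {{}} b m \<cong> F_in_degree (-1) m"
proof -
  have C: "a \<in> carrier (chain_group {{}} m) \<longleftrightarrow> (if m = -1 then Poly_Mapping.keys a \<subseteq> {{}} else a = 0)"
    for m and a :: "'a set \<Rightarrow>\<^sub>0 bit"
  proof -
    have "{\<sigma> \<in> {{} :: 'a set}. int (card \<sigma>) = m + 1} = (if m = -1 then {{}} else {})"
      by auto
    then have "carrier (chain_group {{}} m) = {a :: 'a set \<Rightarrow>\<^sub>0 bit. Poly_Mapping.keys a \<subseteq> (if m = -1 then {{}} else {})}"
      by (simp only: carrier_chain_group)
    then show ?thesis by (cases "m = -1") simp_all
  qed
  \<comment> \<open>The only possible key is the empty simplex, which has no vertex to
    delete.\<close>
  have d: "differential {{}} b a = 0" if "a \<in> carrier (chain_group {{}} m)" for m a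
    unfolding differential_def
    by (rule sum.neutral) (use chain_group_keysD[OF that] in auto)
  have im: "differential {{}} b ` carrier (chain_group {{}} (m + 1)) = {0}"
    using d chain_group_closed(1)[of "{{}}" "m + 1"] by (auto simp: image_iff)
  let ?Z = "cycle_group {{}} b m" and ?h = "\<lambda>a. Poly_Mapping.lookup a {}"
  have Z: "a \<in> carrier ?Z \<longleftrightarrow> (if m = -1 then Poly_Mapping.keys a \<subseteq> {{}} else a = 0)" for a
    using d[of a m] by (simp add: cycle_group_simps flip: C) blast
  interpret h: group_hom ?Z "F_in_degree (-1) m" ?h
  proof (intro group_hom.intro group_hom_axioms.intro homI)
    show "group ?Z" by (rule comm_group.axioms(2), rule comm_group_cycle_group[of "{}"]) auto
    show "group (F_in_degree (-1) m)" by (rule group_F_in_degree)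
  qed (auto simp: Z F_in_degree_def cycle_group_simps(2) lookup_add simp del: add_bit_eq_xor split: if_splits)
  have "kernel ?Z (F_in_degree (-1) m) ?h = {0}"
  proof (intro equalityI subsetI)
    fix a assume "a \<in> kernel ?Z (F_in_degree (-1) m) ?h"
    then have "Poly_Mapping.keys a \<subseteq> {{}}" "{} \<notin> Poly_Mapping.keys a"
      by (auto simp: kernel_def Z F_in_degree_def in_keys_iff split: if_splits)
    then show "a \<in> {0}" by (metis keys_eq_empty singletonI subset_singletonD)
  qed (auto simp: kernel_def Z F_in_degree_def)
  moreover have "?h ` carrier ?Z = carrier (F_in_degree (-1) m)"
  proof (cases "m = -1")
    case True
    have "x \<in> ?h ` carrier ?Z" for x
    proof (rule image_eqI)
      show "Poly_Mapping.single {} x \<in> carrier ?Z" unfolding Z using True by simp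
    qed simp
    then show ?thesis by (auto simp: F_in_degree_def True)
  next
    case False
    then have "carrier ?Z = {0}" using Z by auto
    then show ?thesis using False by (auto simp: F_in_degree_def)
  qed
  ultimately show ?thesis using h.FactGroup_iso by (simp add: homology_def im)
qed

section \<open>Matching complexes and their augmentation\<close>

lemma Match_subset: "\<tau> \<in> Match H \<Longrightarrow> \<sigma> \<subseteq> \<tau> \<Longrightarrow> \<sigma> \<in> Match H"
  by (auto simp: Match_def intro: finite_subset pairwise_subset)

lemma empty_in_Match: "{} \<in> Match H"
  by (simp add: Match_def)

text \<open>The empty matching serves as the augmentation generator of degree -1.\<close>

lemma insert_empty_matching_complex: "insert {} (matching_complex H) = Match H"
  using empty_in_Match by (auto simp: matching_complex_def)

lemma pairwise_Plus:
  assumes "\<And>x y. R x y \<Longrightarrow> R y x"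
  shows "pairwise R (A <+> B) \<longleftrightarrow> pairwise (\<lambda>x y. R (Inl x) (Inl y)) A \<and>
    pairwise (\<lambda>x y. R (Inr x) (Inr y)) B \<and> (\<forall>x\<in>A. \<forall>y\<in>B. R (Inl x) (Inr y))"
  using assms by (auto simp: pairwise_def Plus_def)

lemma finite_Match: "finite (edges H) \<Longrightarrow> finite (Match H)"
  by (rule finite_subset[of _ "Pow (edges H)"]) (auto simp: Match_def)

text \<open>Without the empty matching the family is no longer closed under subsets, but a set
  containing a nonempty matching is nonempty, so convexity survives.\<close>

lemma convex_matching_complex:
  "\<rho> \<in> matching_complex H \<Longrightarrow> \<tau> \<in> matching_complex H \<Longrightarrow> \<rho> \<subseteq> \<sigma> \<Longrightarrow> \<sigma> \<subseteq> \<tau> \<Longrightarrow> \<sigma> \<in> matching_complex H"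
  using Match_subset[of \<tau> H \<sigma>] by (auto simp: matching_complex_def)

lemma group_reduced_homology:
  assumes "finite (edges H)"
  shows "group (reduced_homology (matching_complex H) n)"
  unfolding reduced_homology_def insert_empty_matching_complex
proof (rule group_homology[OF assms])
  show "Match H \<subseteq> Pow (edges H)" by (auto simp: Match_def)
qed (rule Match_subset)

lemma group_simplicial_homology:
  assumes "finite (edges H)"
  shows "group (simplicial_homology (matching_complex H) n)"
  unfolding simplicial_homology_def
proof (rule group_homology[OF assms])
  show "matching_complex H \<subseteq> Pow (edges H)" by (auto simp: matching_complex_def Match_def)
qed (rule convex_matching_complex)

section \<open>Matchings of the overlaid Tait graph\<close>

lemma edges_barycentric: "edges (barycentric c H) = edges H \<times> UNIV"
  by (simp add: barycentric_def)

lemma ends_barycentric_delete_covered: "ends (barycentric c (delete_covered G D c \<mu>)) = ends (barycentric c G)"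
  by (simp add: barycentric_def delete_covered_def fun_eq_iff)

lemma ends_overlaid_Tait:
  "ends (overlaid_Tait G D c) (Inl x) = ends (barycentric c G) x"
  "ends (overlaid_Tait G D c) (Inr y) = ends (barycentric c D) y"
  by (simp_all add: overlaid_Tait_def)

context
  fixes G D :: "'e plane_graph" and c :: "'e \<Rightarrow> complex"
  assumes G: "finite_plane_graph G" and dual: "plane_dual G D c"
begin

text \<open>The vertices of the dual avoid the drawing of \<open>G\<close>, which contains both
  endpoints of the half-edge.\<close>

lemma barycentric_ends_primal:
  assumes "e \<in> edges G"
  obtains p where "ends (barycentric c G) (e, s) = {c e, p}" "p \<in> verts G" "p \<notin> verts D"
    "c e \<notin> verts G" "c e \<notin> verts D"
proof -
  let ?p = "if s then pathfinish (curve G e) else pathstart (curve G e)"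
  have "?p \<in> verts G" using G assms by (auto simp: finite_plane_graph_def)
  moreover have "verts D \<inter> drawing G = {}" "c e \<in> path_image (curve G e)" "c e \<notin> verts G"
    using dual assms by (auto simp: plane_dual_def)
  moreover have "ends (barycentric c G) (e, s) = {c e, ?p}" by (simp add: barycentric_def)
  ultimately show thesis
    using assms by (intro that[of ?p]) (auto simp: drawing_def)
qed

lemma barycentric_ends_dual:
  assumes "e \<in> edges G"
  obtains q where "ends (barycentric c D) (e, s) = {c e, q}" "q \<in> verts D" "q \<notin> verts G"
    "c e \<notin> verts G" "c e \<notin> verts D"
proof -
  let ?q = "if s then pathfinish (curve D e) else pathstart (curve D e)"
  have "finite_plane_graph D" "edges D = edges G" "verts D \<inter> drawing G = {}"
    using dual by (auto simp: plane_dual_def)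
  then have q: "?q \<in> verts D" and "verts D \<inter> verts G = {}"
    using assms by (auto simp: finite_plane_graph_def drawing_def)
  then have "?q \<notin> verts G" by blast
  note q this
  moreover have "ends (barycentric c D) (e, s) = {c e, ?q}" by (simp add: barycentric_def)
  ultimately show thesis
    using that[of ?q] barycentric_ends_primal[OF assms] by metis
qed

lemma edges_dual: "edges D = edges G"
  using dual by (simp add: plane_dual_def)

text \<open>Primal vertices, dual vertices and crossing points are mutually distinct, so a common
  endpoint can only be a crossing point. The right-hand side is phrased like the deletion condition
  in \<open>delete_covered\<close>.\<close>

lemma disjnt_primal_dual_half_edges:
  assumes "e \<in> edges G" "f \<in> edges G"
  shows "disjnt (ends (barycentric c G) (e, s)) (ends (barycentric c D) (f, t))
    \<longleftrightarrow> c e \<notin> ends (barycentric c D) (f, t)"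
proof -
  obtain p where "ends (barycentric c G) (e, s) = {c e, p}" "p \<in> verts G" "p \<notin> verts D" "c e \<notin> verts D"
    using barycentric_ends_primal[OF assms(1)] by metis
  moreover obtain q where "ends (barycentric c D) (f, t) = {c f, q}" "q \<in> verts D" "c f \<notin> verts G"
    using barycentric_ends_dual[OF assms(2)] by metis
  ultimately show ?thesis by (auto simp: disjnt_def)
qed

text \<open>Disjointness within \<open>A <+> \<mu>\<close> splits into disjointness within
  \<open>A\<close>, within \<mu>, and between them; the mixed condition says exactly that
  \<open>A\<close> uses only edges left by deleting those covered by \<mu>.\<close>

lemma Match_overlaid_Tait_iff:
  "A <+> \<mu> \<in> Match (overlaid_Tait G D c) \<longleftrightarrow>
     \<mu> \<in> Match (barycentric c D) \<and> A \<in> Match (barycentric c (delete_covered G D c \<mu>))"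
proof (cases "A \<subseteq> edges G \<times> UNIV \<and> \<mu> \<subseteq> edges G \<times> UNIV")
  case True
  have "pairwise (\<lambda>x y. disjnt (ends (overlaid_Tait G D c) x) (ends (overlaid_Tait G D c) y)) (A <+> \<mu>) \<longleftrightarrow>
      pairwise (\<lambda>x y. disjnt (ends (barycentric c G) x) (ends (barycentric c G) y)) A \<and>
      pairwise (\<lambda>x y. disjnt (ends (barycentric c D) x) (ends (barycentric c D) y)) \<mu> \<and>
      (\<forall>x\<in>A. \<forall>y\<in>\<mu>. disjnt (ends (barycentric c G) x) (ends (barycentric c D) y))"
    by (subst pairwise_Plus) (simp_all add: ends_overlaid_Tait disjnt_sym)
  moreover have "(\<forall>x\<in>A. \<forall>y\<in>\<mu>. disjnt (ends (barycentric c G) x) (ends (barycentric c D) y)) \<longleftrightarrow>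
      A \<subseteq> edges (barycentric c (delete_covered G D c \<mu>))"
  proof -
    have "(\<forall>y\<in>\<mu>. disjnt (ends (barycentric c G) x) (ends (barycentric c D) y)) \<longleftrightarrow>
        x \<in> edges (barycentric c (delete_covered G D c \<mu>))" if xA: "x \<in> A" for x
    proof -
      obtain e s where x: "x = (e, s)" "e \<in> edges G" using True xA by (cases x) auto
      have "disjnt (ends (barycentric c G) x) (ends (barycentric c D) y) \<longleftrightarrow> c e \<notin> ends (barycentric c D) y"
        if "y \<in> \<mu>" for y
        using True that x disjnt_primal_dual_half_edges by (cases y) auto
      then show ?thesis using x by (auto simp: edges_barycentric delete_covered_def)
    qed
    then show ?thesis by blast
  qed
  ultimately show ?thesis
    using True
    by (auto simp: Match_def ends_barycentric_delete_covered edges_barycentric edges_dual overlaid_Tait_def)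
\<comment> \<open>If some half-edge does not come from an edge of \<open>G\<close>, both sides are
  false.\<close>
next
  case False
  then show ?thesis
    by (auto simp: Match_def edges_barycentric edges_dual overlaid_Tait_def delete_covered_def)
qed

lemma Match_overlaid_Tait:
  "Match (overlaid_Tait G D c) =
    (\<Union>\<mu>\<in>Match (barycentric c D). (\<lambda>A. A <+> \<mu>) ` Match (barycentric c (delete_covered G D c \<mu>)))"
proof -
  \<comment> \<open>Every set of half-edges is the sum of its primal and dual parts, so the
    characterization above reaches all matchings.\<close>
  have "\<sigma> = Inl -` \<sigma> <+> Inr -` \<sigma>" for \<sigma> :: "('e \<times> bool + 'e \<times> bool) set"
  proof (rule Set.set_eqI)
    show "x \<in> \<sigma> \<longleftrightarrow> x \<in> Inl -` \<sigma> <+> Inr -` \<sigma>" for x by (cases x) auto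
  qed
  then show ?thesis
    using Match_overlaid_Tait_iff by (auto simp: image_iff) metis
qed

lemma Tait_colouring_half_edge:
  assumes "fst x \<in> edges G"
  shows "Tait_colouring G D c (Inl x) = Black" "Tait_colouring G D c (Inr x) = White"
proof -
  obtain e s where x: "x = (e, s)" "e \<in> edges G" using assms by (cases x) auto
  show "Tait_colouring G D c (Inl x) = Black"
    by (rule barycentric_ends_primal[OF x(2), of s]) (auto simp: x Tait_colouring_def ends_overlaid_Tait)
  show "Tait_colouring G D c (Inr x) = White"
    by (rule barycentric_ends_dual[OF x(2), of s]) (auto simp: x Tait_colouring_def ends_overlaid_Tait)
qed

section \<open>Weight classes and their horizontal homology\<close>

lemma weight_Plus:
  assumes "A \<subseteq> edges G \<times> UNIV" "\<mu> \<subseteq> edges G \<times> UNIV"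
  shows "weight (Tait_colouring G D c) (A <+> \<mu>) = card \<mu>"
proof -
  have "{v \<in> A <+> \<mu>. Tait_colouring G D c v = White} = Inr ` \<mu>"
    using assms Tait_colouring_half_edge by (fastforce simp: Plus_def)
  then show ?thesis by (simp add: weight_def card_image)
qed

lemma weight_class:
  "{\<sigma> \<in> Match (overlaid_Tait G D c). weight (Tait_colouring G D c) \<sigma> = k} =
    (\<Union>\<mu>\<in>{\<mu> \<in> Match (barycentric c D). card \<mu> = k}.
      (\<lambda>A. A <+> \<mu>) ` Match (barycentric c (delete_covered G D c \<mu>)))"
proof -
  have "weight (Tait_colouring G D c) (A <+> \<mu>) = card \<mu>"
    if "\<mu> \<in> Match (barycentric c D)" "A \<in> Match (barycentric c (delete_covered G D c \<mu>))" for A \<mu>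
    using that
    by (intro weight_Plus) (auto simp: Match_def edges_barycentric edges_dual delete_covered_def)
  then show ?thesis unfolding Match_overlaid_Tait by auto
qed

text \<open>The blocks \<open>K\<close> are left open so that one statement serves both cases: all
  matchings for positive weight, and only nonempty ones for weight 0.\<close>

lemma horizontal_homology_iso:
  assumes K: "\<And>\<mu>. \<mu> \<in> Match (barycentric c D) \<Longrightarrow> card \<mu> = k \<Longrightarrow>
      K \<mu> \<subseteq> Match (barycentric c (delete_covered G D c \<mu>))"
    and convex: "\<And>\<mu> \<rho> \<sigma> \<tau>. \<rho> \<in> K \<mu> \<Longrightarrow> \<tau> \<in> K \<mu> \<Longrightarrow> \<rho> \<subseteq> \<sigma> \<Longrightarrow> \<sigma> \<subseteq> \<tau> \<Longrightarrow> \<sigma> \<in> K \<mu>"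
    and eq: "{\<sigma> \<in> matching_complex (overlaid_Tait G D c). weight (Tait_colouring G D c) \<sigma> = k} =
      (\<Union>\<mu>\<in>{\<mu> \<in> Match (barycentric c D). card \<mu> = k}. (\<lambda>A. A <+> \<mu>) ` K \<mu>)"
  shows "horizontal_homology (matching_complex (overlaid_Tait G D c)) (Tait_colouring G D c) k n \<cong>
    sum_group {\<mu> \<in> Match (barycentric c D). card \<mu> = k} (\<lambda>\<mu>. homology (K \<mu>) (\<lambda>_. True) (n - int k))"
  unfolding horizontal_homology_def eq
proof (rule homology_Plus_iso)
  have fin: "finite (edges G)" using G by (simp add: finite_plane_graph_def)
  then show "finite (edges G \<times> (UNIV :: bool set))" by simp
  show "finite {\<mu> \<in> Match (barycentric c D). card \<mu> = k}"
    using fin by (intro finite_subset[OF _ finite_Match]) (auto simp: edges_barycentric edges_dual)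
  show "K \<mu> \<subseteq> Pow (edges G \<times> UNIV)" if "\<mu> \<in> {\<mu> \<in> Match (barycentric c D). card \<mu> = k}" for \<mu>
    using K[of \<mu>] that by (fastforce simp: Match_def edges_barycentric delete_covered_def)
  show "\<not> Tait_colouring G D c (Inr y) = Black"
    if "\<mu> \<in> {\<mu> \<in> Match (barycentric c D). card \<mu> = k}" "y \<in> \<mu>" for \<mu> y
    using that Tait_colouring_half_edge(2)[of y] by (auto simp: Match_def edges_barycentric edges_dual)
  show "Tait_colouring G D c (Inl x) = Black" if "x \<in> edges G \<times> UNIV" for x
    using that Tait_colouring_half_edge(1)[of x] by auto
  show "finite \<mu> \<and> card \<mu> = k" if "\<mu> \<in> {\<mu> \<in> Match (barycentric c D). card \<mu> = k}" for \<mu>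
    using that by (simp add: Match_def)
qed (rule convex)

end

text \<open>Only the empty matching remains, giving a class in degree -1; and
  \<open>n - k = -1\<close> means \<open>n = k - 1\<close>.\<close>

lemma reduced_homology_no_edges_iso:
  assumes "edges H = {}"
  shows "reduced_homology (matching_complex H) (n - int k) \<cong> F_in_degree (int k - 1) n"
proof -
  have "Match H = {{}}" using assms by (auto simp: Match_def)
  moreover have "F_in_degree (-1) (n - int k) = F_in_degree (int k - 1) n"
    by (auto simp: F_in_degree_def)
  ultimately show ?thesis
    using homology_empty_simplex_iso[of "\<lambda>_. True" "n - int k"]
    by (simp add: reduced_homology_def insert_empty_matching_complex)
qed

theorem theorem4p2:
  fixes G D :: "'e plane_graph" and c :: "'e \<Rightarrow> complex"
  assumes "finite_plane_graph G" and "connected_graph G" and "plane_dual G D c"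
  shows "(\<forall>k>0. \<forall>n::int.
            horizontal_homology (matching_complex (overlaid_Tait G D c)) (Tait_colouring G D c) k n
            \<cong> sum_group
                 {\<mu> \<in> Match (barycentric c D). edges (delete_covered G D c \<mu>) \<noteq> {} \<and> card \<mu> = k}
                 (\<lambda>\<mu>. reduced_homology
                    (matching_complex (barycentric c (delete_covered G D c \<mu>))) (n - int k))
              \<times>\<times> sum_group
                 {\<mu> \<in> Match (barycentric c D). edges (delete_covered G D c \<mu>) = {} \<and> card \<mu> = k}
                 (\<lambda>\<mu>. F_in_degree (int k - 1) n))
       \<and> (\<forall>n::int.
            horizontal_homology (matching_complex (overlaid_Tait G D c)) (Tait_colouring G D c) 0 n
            \<cong> simplicial_homology (matching_complex (barycentric c G)) n)"
proof (intro conjI allI impI)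
  note iso = horizontal_homology_iso[OF assms(1,3)] and weight_class = weight_class[OF assms(1,3)]
  let ?M = "Match (barycentric c D)"
  have fin: "finite (edges G)" using assms(1) by (simp add: finite_plane_graph_def)
  have fin_sub: "finite (edges (barycentric c (delete_covered G D c \<mu>)))" for \<mu>
    using fin by (simp add: barycentric_def delete_covered_def)
  have finM: "finite ?M"
    using fin edges_dual[OF assms(1,3)] by (intro finite_Match) (simp add: barycentric_def)
  show "horizontal_homology (matching_complex (overlaid_Tait G D c)) (Tait_colouring G D c) k n
      \<cong> sum_group {\<mu> \<in> ?M. edges (delete_covered G D c \<mu>) \<noteq> {} \<and> card \<mu> = k}
          (\<lambda>\<mu>. reduced_homology (matching_complex (barycentric c (delete_covered G D c \<mu>))) (n - int k))
        \<times>\<times> sum_group {\<mu> \<in> ?M. edges (delete_covered G D c \<mu>) = {} \<and> card \<mu> = k}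
          (\<lambda>\<mu>. F_in_degree (int k - 1) n)" (is "?H \<cong> sum_group ?I ?R \<times>\<times> sum_group ?J ?F")
    if k: "k > 0" for k n
  proof -
    \<comment> \<open>The empty matching has weight 0, so excluding it changes nothing in positive
      weight. Hence every block contains \<open>A = {}\<close> and is augmented.\<close>
    have "{\<sigma> \<in> matching_complex (overlaid_Tait G D c). weight (Tait_colouring G D c) \<sigma> = k} =
        {\<sigma> \<in> Match (overlaid_Tait G D c). weight (Tait_colouring G D c) \<sigma> = k}"
      using k by (auto simp: matching_complex_def weight_def)
    then have "?H \<cong> sum_group {\<mu> \<in> ?M. card \<mu> = k} ?R"
      unfolding reduced_homology_def insert_empty_matching_complex
      by (intro iso) (auto simp: weight_class intro: Match_subset)
    also have "{\<mu> \<in> ?M. card \<mu> = k} = ?I \<union> ?J" by auto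
    also have "sum_group (?I \<union> ?J) ?R \<cong> sum_group ?I ?R \<times>\<times> sum_group ?J ?R"
      using finM group_reduced_homology[OF fin_sub] by (intro sum_group_split_iso) auto
    also have "\<dots> \<cong> sum_group ?I ?R \<times>\<times> sum_group ?J ?F"
    proof (rule group.DirProd_iso_trans)
      show "group (sum_group ?I ?R)" using group_reduced_homology[OF fin_sub] by (rule sum_group)
      show "sum_group ?I ?R \<cong> sum_group ?I ?R" by (rule iso_refl)
      show "sum_group ?J ?R \<cong> sum_group ?J ?F"
      proof (rule iso_sum_groupI)
        show "?R \<mu> \<cong> ?F \<mu>" if "\<mu> \<in> ?J" for \<mu>
          using that by (intro reduced_homology_no_edges_iso) (auto simp: barycentric_def)
      qed (simp_all add: group_reduced_homology[OF fin_sub] group_F_in_degree)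
    qed
    finally show ?thesis .
  qed
  show "horizontal_homology (matching_complex (overlaid_Tait G D c)) (Tait_colouring G D c) 0 n
      \<cong> simplicial_homology (matching_complex (barycentric c G)) n" (is "?H \<cong> _") for n
  proof -
    let ?K = "\<lambda>\<mu>. matching_complex (barycentric c (delete_covered G D c \<mu>))"
    \<comment> \<open>Matchings are finite by definition, so cardinality 0 does mean empty.\<close>
    have M0: "{\<mu> \<in> ?M. card \<mu> = 0} = {{}}"
      by (auto simp: Match_def)
    have "{\<sigma> \<in> matching_complex (overlaid_Tait G D c). weight (Tait_colouring G D c) \<sigma> = 0} =
        {\<sigma> \<in> Match (overlaid_Tait G D c). weight (Tait_colouring G D c) \<sigma> = 0} - {{}}"
      by (auto simp: matching_complex_def)
    \<comment> \<open>The single block has \<open>\<mu> = {}\<close>, and \<open>A <+> {}\<close> is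
      empty only for empty \<open>A\<close>. Removing the empty set thus removes the augmentation
      generator, leaving unreduced homology.\<close>
    also have "\<dots> = (\<Union>\<mu>\<in>{\<mu> \<in> ?M. card \<mu> = 0}. (\<lambda>A. A <+> \<mu>) ` ?K \<mu>)"
      unfolding weight_class M0 by (auto simp: matching_complex_def)
    finally have "?H \<cong> sum_group {\<mu> \<in> ?M. card \<mu> = 0} (\<lambda>\<mu>. homology (?K \<mu>) (\<lambda>_. True) (n - int 0))"
      by (intro iso) (auto simp: matching_complex_def intro: Match_subset)
    also have "\<dots> = sum_group {{}} (\<lambda>\<mu>. simplicial_homology (?K \<mu>) n)"
      by (simp add: M0 simplicial_homology_def)
    also have "\<dots> \<cong> simplicial_homology (?K {}) n"
      using group_simplicial_homology[OF fin_sub] by (rule sum_group_singleton_iso)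
    also have "delete_covered G D c {} = G" by (simp add: delete_covered_def)
    finally show ?thesis .
  qed
qed

end
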